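(* Let $A\in\mathbb{R}^{m\times n}$, let $C\in\mathbb{R}^{n\times n}$ be symmetric positive definite, and let $B=CA^{\mathrm T}$. Then, for arbitrary $b\in\mathbb{R}^m$ and arbitrary initial iterate $x_0\in\mathbb{R}^n$, RRGMRES right preconditioned with $B$ determines a least squares solution of $\min_{x\in\mathbb{R}^n}\|b-Ax\|_2$ without breakdown.
   Context: RRGMRES for a square system $Gw=c$, $G\in\mathbb{R}^{m\times m}$, with initial iterate $w_0$: put $s_0=c-Gw_0$. If $Gs_0=0$ the method stops at step $0$ with $w_0$. Otherwise put $v_1=Gs_0/\|Gs_0\|_2$ and for $j=1,2,\dots$ carry out the Arnoldi process: $h_{i,j}=v_i^{\mathrm T}Gv_j$ for $1\le i\le j$, $\hat v_{j+1}=Gv_j-\sum_{i=1}^{j}h_{i,j}v_i$, $h_{j+1,j}=\|\hat v_{j+1}\|_2$; if $h_{j+1,j}=0$ the process terminates at step $j$, otherwise $v_{j+1}=\hat v_{j+1}/h_{j+1,j}$. The $k$th iterate is $w_k=w_0+[v_1,\dots,v_k]y_k$, where $y_k\in\mathbb{R}^k$ minimizes $\|c-G(w_0+[v_1,\dots,v_k]y)\|_2$. RRGMRES right preconditioned with $B\in\mathbb{R}^{n\times m}$ for $\min_x\|b-Ax\|_2$ with initial iterate $x_0$: with $r_0=b-Ax_0$, apply RRGMRES to $ABw=r_0$ with $w_0=0$, and set $x_k=x_0+Bw_k$. "Determines a least squares solution without breakdown" means that the method does not terminate before a least squares solution has been reached, i.e. the iterate at the step where the method terminates (which may be step $0$)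 is a least squares solution. *)

theory Defs
  imports "HOL-Analysis.Analysis"
begin

definition symmetric_positive_definite :: "real^'n^'n \<Rightarrow> bool" where
  "symmetric_positive_definite C \<longleftrightarrow>
     transpose C = C \<and> (\<forall>x. x \<noteq> 0 \<longrightarrow> 0 < x \<bullet> (C *v x))"

definition least_squares_solution :: "real^'n^'m \<Rightarrow> real^'m \<Rightarrow> real^'n \<Rightarrow> bool" where
  "least_squares_solution A b = is_arg_min (\<lambda>x. norm (b - A *v x)) (\<lambda>_. True)"

(* Vectors are numbered from 1; index 0 is a dummy. Since division by 0 gives 0, the
   recursion is total, and the vectors beyond the termination step are junk; they are
   excluded by rrgmres_terminates_at below. *)
fun arnoldi_vec :: "real^'m^'m \<Rightarrow> real^'m \<Rightarrow> nat \<Rightarrow> real^'m" where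
  "arnoldi_vec G s 0 = 0"
| "arnoldi_vec G s (Suc 0) = (G *v s) /\<^sub>R norm (G *v s)"
| "arnoldi_vec G s (Suc (Suc j)) =
     (let u = G *v arnoldi_vec G s (Suc j);
          vhat = u - (\<Sum>i = 1..Suc j. (arnoldi_vec G s i \<bullet> u) *\<^sub>R arnoldi_vec G s i)
      in vhat /\<^sub>R norm vhat)"

(* The subdiagonal entry h_{j+1,j} of the Hessenberg matrix, for j \<ge> 1. *)
definition arnoldi_subdiag :: "real^'m^'m \<Rightarrow> real^'m \<Rightarrow> nat \<Rightarrow> real" where
  "arnoldi_subdiag G s j =
     norm (G *v arnoldi_vec G s j -
       (\<Sum>i = 1..j. (arnoldi_vec G s i \<bullet> (G *v arnoldi_vec G s j)) *\<^sub>R arnoldi_vec G s i))"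

definition rrgmres_terminates_at ::
    "real^'m^'m \<Rightarrow> real^'m \<Rightarrow> real^'m \<Rightarrow> nat \<Rightarrow> bool" where
  "rrgmres_terminates_at G c w0 k \<longleftrightarrow>
     (let s0 = c - G *v w0 in
      if G *v s0 = 0 then k = 0
      else 1 \<le> k \<and> arnoldi_subdiag G s0 k = 0 \<and>
           (\<forall>j. 1 \<le> j \<and> j < k \<longrightarrow> arnoldi_subdiag G s0 j \<noteq> 0))"

(* The point w0 + [v_1, ..., v_k] y, where only the entries y 1, ..., y k matter. *)
definition rrgmres_point ::
    "real^'m^'m \<Rightarrow> real^'m \<Rightarrow> real^'m \<Rightarrow> nat \<Rightarrow> (nat \<Rightarrow> real) \<Rightarrow> real^'m" where
  "rrgmres_point G c w0 k y =
     w0 + (\<Sum>i = 1..k. y i *\<^sub>R arnoldi_vec G (c - G *v w0) i)"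

(* A relation, since the minimizing coefficient vector need not be unique a priori.
   For k = 0 the only iterate is w0. *)
definition rrgmres_iterate ::
    "real^'m^'m \<Rightarrow> real^'m \<Rightarrow> real^'m \<Rightarrow> nat \<Rightarrow> real^'m \<Rightarrow> bool" where
  "rrgmres_iterate G c w0 k w \<longleftrightarrow>
     (\<exists>y. is_arg_min (\<lambda>y. norm (c - G *v rrgmres_point G c w0 k y)) (\<lambda>_. True) y \<and>
          w = rrgmres_point G c w0 k y)"

definition right_rrgmres_terminates_at ::
    "real^'n^'m \<Rightarrow> real^'m^'n \<Rightarrow> real^'m \<Rightarrow> real^'n \<Rightarrow> nat \<Rightarrow> bool" where
  "right_rrgmres_terminates_at A B b x0 k \<longleftrightarrow>
     rrgmres_terminates_at (A ** B) (b - A *v x0) 0 k"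

definition right_rrgmres_iterate ::
    "real^'n^'m \<Rightarrow> real^'m^'n \<Rightarrow> real^'m \<Rightarrow> real^'n \<Rightarrow> nat \<Rightarrow> real^'n \<Rightarrow> bool" where
  "right_rrgmres_iterate A B b x0 k x \<longleftrightarrow>
     (\<exists>w. rrgmres_iterate (A ** B) (b - A *v x0) 0 k w \<and> x = x0 + B *v w)"

(* The method does terminate, an iterate exists at that step, and whichever minimizer is
   chosen there, the iterate is a least squares solution. *)
definition right_rrgmres_determines_ls_without_breakdown ::
    "real^'n^'m \<Rightarrow> real^'m^'n \<Rightarrow> real^'m \<Rightarrow> real^'n \<Rightarrow> bool" where
  "right_rrgmres_determines_ls_without_breakdown A B b x0 \<longleftrightarrow>
     (\<exists>k. right_rrgmres_terminates_at A B b x0 k \<and>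
          (\<exists>x. right_rrgmres_iterate A B b x0 k x) \<and>
          (\<forall>x. right_rrgmres_iterate A B b x0 k x \<longrightarrow> least_squares_solution A b x))"

end

(* Write G = A C A^T, which is symmetric, and let V = span {v_1, ..., v_k} at the
   termination step k.  Then V is G-invariant and contains G s_0, so the final residual
   r = s_0 - G w satisfies G r \<in> V.  By minimality r is orthogonal to G V, so by symmetry
   G r is orthogonal to V.  Hence G r = 0, and positive definiteness of C turns this into
   the normal equations A^T r = 0. *)

theory Submission
  imports Defs
begin

section \<open>Normal equations and the congruence by A\<close>

text \<open>The residual is orthogonal to the range of \<open>A\<close>, so replacing
  \<open>x\<close> by any \<open>y\<close> adds an orthogonal vector to it, which by Pythagoras
  cannot shorten it.\<close>

lemma least_squares_solutionI_normal_equations: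
  fixes A :: "real^'n^'m"
  assumes "transpose A *v (b - A *v x) = 0"
  shows "least_squares_solution A b x"
  unfolding least_squares_solution_def is_arg_min_linorder
proof (intro conjI allI impI TrueI)
  fix y :: "real^'n"
  have "orthogonal (b - A *v x) (A *v (x - y))"
    using assms by (simp add: orthogonal_def dot_lmul_matrix [symmetric])
  then have "(norm ((b - A *v x) + A *v (x - y)))\<^sup>2
      = (norm (b - A *v x))\<^sup>2 + (norm (A *v (x - y)))\<^sup>2"
    by (rule norm_add_Pythagorean)
  moreover have "(b - A *v x) + A *v (x - y) = b - A *v y"
    by (simp add: matrix_vector_mult_diff_distrib)
  ultimately have "(norm (b - A *v x))\<^sup>2 \<le> (norm (b - A *v y))\<^sup>2"
    by simp
  then show "norm (b - A *v x) \<le> norm (b - A *v y)"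
    by (simp add: power2_le_iff_abs_le)
qed

lemma symmetric_congruence:
  fixes A :: "real^'n^'m"
  assumes "transpose C = C"
  shows "transpose (A ** (C ** transpose A)) = A ** (C ** transpose A)"
  by (simp add: matrix_transpose_mul assms matrix_mul_assoc)

text \<open>Pairing the hypothesis with \<open>r\<close> gives the quadratic form of
  \<open>C\<close> at \<open>transpose A *v r\<close>, which is positive unless that vector
  vanishes.\<close>

lemma kernel_congruence:
  fixes A :: "real^'n^'m"
  assumes "symmetric_positive_definite C" and "(A ** (C ** transpose A)) *v r = 0"
  shows "transpose A *v r = 0"
proof (rule ccontr)
  assume "transpose A *v r \<noteq> 0"
  then have "0 < (transpose A *v r) \<bullet> (C *v (transpose A *v r))"
    using assms(1) by (simp add: symmetric_positive_definite_def)
  also have "\<dots> = r \<bullet> ((A ** (C ** transpose A)) *v r)"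
    by (simp add: matrix_vector_mul_assoc [symmetric] flip: dot_lmul_matrix)
  finally show False
    using assms(2) by simp
qed

section \<open>Best approximation by finite linear combinations\<close>

text \<open>The span is written as a range over coefficient functions because iterates are defined
  by minimizing over coefficients.\<close>

lemma subspace_combinations:
  fixes u :: "nat \<Rightarrow> 'a::real_vector"
  shows "subspace (range (\<lambda>y. \<Sum>i = 1..k. y i *\<^sub>R u i))"
  unfolding subspace_def
proof (intro conjI ballI allI)
  show "0 \<in> range (\<lambda>y. \<Sum>i = 1..k. y i *\<^sub>R u i)"
    by (rule range_eqI [of _ _ "\<lambda>_. 0"]) simp
next
  fix p q
  assume "p \<in> range (\<lambda>y. \<Sum>i = 1..k. y i *\<^sub>R u i)" "q \<in> range (\<lambda>y. \<Sum>i = 1..k. y i *\<^sub>R u i)"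
  then obtain y z where "p = (\<Sum>i = 1..k. y i *\<^sub>R u i)" "q = (\<Sum>i = 1..k. z i *\<^sub>R u i)"
    by blast
  then show "p + q \<in> range (\<lambda>y. \<Sum>i = 1..k. y i *\<^sub>R u i)"
    by (intro range_eqI [of _ _ "\<lambda>i. y i + z i"]) (simp add: scaleR_add_left sum.distrib)
next
  fix c p
  assume "p \<in> range (\<lambda>y. \<Sum>i = 1..k. y i *\<^sub>R u i)"
  then obtain y where "p = (\<Sum>i = 1..k. y i *\<^sub>R u i)"
    by blast
  then show "c *\<^sub>R p \<in> range (\<lambda>y. \<Sum>i = 1..k. y i *\<^sub>R u i)"
    by (intro range_eqI [of _ _ "\<lambda>i. c * y i"]) (simp add: scaleR_sum_right)
qed

lemma ex_best_combination:
  fixes u :: "nat \<Rightarrow> 'a::euclidean_space"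
  shows "\<exists>y. is_arg_min (\<lambda>y. norm (a - (\<Sum>i = 1..k. y i *\<^sub>R u i))) (\<lambda>_. True) y"
proof -
  let ?W = "range (\<lambda>y. \<Sum>i = 1..k. y i *\<^sub>R u i)"
  have "closed ?W"
    by (intro closed_subspace subspace_combinations)
  from closest_point_exists [OF this, of a]
  have "closest_point ?W a \<in> ?W" "\<forall>p\<in>?W. dist a (closest_point ?W a) \<le> dist a p"
    by auto
  then obtain y where
    "\<forall>p\<in>?W. dist a (\<Sum>i = 1..k. y i *\<^sub>R u i) \<le> dist a p"
    by (metis (no_types, lifting) imageE)
  then show ?thesis
    by (intro exI [of _ y]) (simp add: is_arg_min_linorder dist_norm)
qed

text \<open>The variational inequality for the closest point \<open>p\<close>, tested at
  \<open>p + u j\<close> and at \<open>p - u j\<close>, bounds the same inner product by 0 from both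
  sides.\<close>

lemma best_combination_orthogonal:
  fixes u :: "nat \<Rightarrow> 'a::euclidean_space"
  assumes min: "is_arg_min (\<lambda>y. norm (a - (\<Sum>i = 1..k. y i *\<^sub>R u i))) (\<lambda>_. True) y"
    and j: "j \<in> {1..k}"
  shows "(a - (\<Sum>i = 1..k. y i *\<^sub>R u i)) \<bullet> u j = 0"
proof -
  define W where "W = range (\<lambda>y. \<Sum>i = 1..k. y i *\<^sub>R u i)"
  define p where "p = (\<Sum>i = 1..k. y i *\<^sub>R u i)"
  have W: "subspace W"
    unfolding W_def by (rule subspace_combinations)
  have p: "p \<in> W"
    by (auto simp: W_def p_def)
  have closest: "\<forall>z\<in>W. dist a p \<le> dist a z"
    using min by (auto simp: is_arg_min_linorder W_def p_def dist_norm)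
  have "(\<Sum>i = 1..k. (if i = j then 1 else 0) *\<^sub>R u i) = u j"
    using j by (simp add: if_distrib [of "\<lambda>c. c *\<^sub>R _"] cong: if_cong)
  then have "u j \<in> W"
    unfolding W_def by (intro range_eqI [of _ _ "\<lambda>i. if i = j then 1 else 0"]) simp
  then have "p + u j \<in> W" "p - u j \<in> W"
    using W p by (auto intro: subspace_add subspace_diff)
  then have "(a - p) \<bullet> (p + u j - p) \<le> 0" "(a - p) \<bullet> (p - u j - p) \<le> 0"
    using any_closest_point_dot [OF subspace_imp_convex [OF W] closed_subspace [OF W] p _ closest]
    by blast+
  then show ?thesis
    by (simp add: p_def)
qed

section \<open>The Arnoldi process and its termination\<close>

text \<open>Free of division, the recurrence also covers the breakdown step: the right-hand side has
  norm \<open>arnoldi_subdiag G s j\<close>, so both sides vanish together.\<close>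

lemma arnoldi_vec_Suc:
  assumes "1 \<le> j"
  shows "arnoldi_subdiag G s j *\<^sub>R arnoldi_vec G s (Suc j) = G *v arnoldi_vec G s j -
    (\<Sum>i = 1..j. (arnoldi_vec G s i \<bullet> (G *v arnoldi_vec G s j)) *\<^sub>R arnoldi_vec G s i)"
proof -
  obtain j' where "j = Suc j'"
    using assms by (cases j) auto
  then show ?thesis
    by (cases "arnoldi_subdiag G s j = 0") (simp_all add: arnoldi_subdiag_def Let_def del: sum.cl_ivl_Suc)
qed

text \<open>This is Gram-Schmidt, by induction on \<open>N\<close>. Nonzero subdiagonal entries are
  required only below \<open>N\<close>, since the entry at \<open>j\<close> normalizes vector
  \<open>j + 1\<close>.\<close>

lemma arnoldi_vec_orthonormal:
  assumes "G *v s \<noteq> 0" and "\<And>j. 1 \<le> j \<Longrightarrow> j < N \<Longrightarrow> arnoldi_subdiag G s j \<noteq> 0"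
    and "i \<in> {1..N}" and "l \<in> {1..N}"
  shows "arnoldi_vec G s i \<bullet> arnoldi_vec G s l = (if i = l then 1 else 0)"
  using assms(2-)
proof (induction N arbitrary: i l)
  case 0
  then show ?case by simp
next
  case (Suc N)
  let ?v = "arnoldi_vec G s"
  have IH: "?v i \<bullet> ?v l = (if i = l then 1 else 0)" if "i \<in> {1..N}" "l \<in> {1..N}" for i l
    using Suc.IH [OF _ that] Suc.prems(1) by simp
  show ?case
  proof (cases "N = 0")
    case True
    then have "i = Suc 0" "l = Suc 0"
      using Suc.prems by auto
    then show ?thesis
      using assms(1) by (simp add: dot_square_norm power2_eq_square)
  next
    case False
    define h where "h = arnoldi_subdiag G s N"
    define u where "u = G *v ?v N"
    have "h \<noteq> 0"
      using Suc.prems(1) False by (simp add: h_def)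
    have next_vec: "h *\<^sub>R ?v (Suc N) = u - (\<Sum>i = 1..N. (?v i \<bullet> u) *\<^sub>R ?v i)"
      using arnoldi_vec_Suc [of N G s] False by (simp add: h_def u_def)
    \<comment> \<open>The right-hand side of \<open>next_vec\<close> has norm \<open>h\<close> by
      definition of the subdiagonal entry.\<close>
    have "\<bar>h\<bar> * norm (?v (Suc N)) = \<bar>h\<bar>"
      using arg_cong [OF next_vec, of norm] by (simp add: h_def u_def arnoldi_subdiag_def)
    then have unit: "?v (Suc N) \<bullet> ?v (Suc N) = 1"
      using \<open>h \<noteq> 0\<close> by (simp add: dot_square_norm)
    have orth: "?v m \<bullet> ?v (Suc N) = 0" if m: "m \<in> {1..N}" for m
    proof -
      \<comment> \<open>By the induction hypothesis only the term \<open>i = m\<close> of the sum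
        survives, and it cancels the first term.\<close>
      have "h * (?v m \<bullet> ?v (Suc N)) = ?v m \<bullet> u - (\<Sum>i = 1..N. (?v i \<bullet> u) * (?v m \<bullet> ?v i))"
        using arg_cong [OF next_vec, of "inner (?v m)"]
        by (simp add: inner_diff_right inner_sum_right)
      also have "(\<Sum>i = 1..N. (?v i \<bullet> u) * (?v m \<bullet> ?v i))
          = (\<Sum>i = 1..N. if m = i then ?v i \<bullet> u else 0)"
        by (intro sum.cong) (auto simp: IH [OF m])
      also have "\<dots> = ?v m \<bullet> u"
        using m by simp
      finally show ?thesis
        using \<open>h \<noteq> 0\<close> by simp
    qed
    consider "i \<in> {1..N}" "l \<in> {1..N}" | "i = Suc N" "l = Suc N"
      | "i \<in> {1..N}" "l = Suc N" | "i = Suc N" "l \<in> {1..N}"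
      using Suc.prems(2,3) by (auto simp: le_Suc_eq)
    then show ?thesis
    proof cases
      case 4
      then show ?thesis
        using orth [of l] by (auto simp: inner_commute simp del: arnoldi_vec.simps)
    qed (use IH unit orth in \<open>auto simp del: arnoldi_vec.simps\<close>)
  qed
qed

text \<open>Without a zero entry the process would yield more orthonormal vectors than the dimension
  of the space.\<close>

lemma ex_arnoldi_subdiag_eq_0:
  fixes G :: "real^'m^'m"
  assumes "G *v s \<noteq> 0"
  shows "\<exists>j\<ge>1. arnoldi_subdiag G s j = 0"
proof (rule ccontr)
  assume no_stop: "\<not> ?thesis"
  define N where "N = Suc (DIM(real^'m))"
  let ?v = "arnoldi_vec G s"
  have orthonormal: "?v i \<bullet> ?v l = (if i = l then 1 else 0)" if "i \<in> {1..N}" "l \<in> {1..N}" for i l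
    using arnoldi_vec_orthonormal [OF assms _ that] no_stop by blast
  \<comment> \<open>Injectivity ensures that the set of these vectors really has \<open>N\<close>
    elements.\<close>
  have "inj_on ?v {1..N}"
    by (rule inj_onI) (metis orthonormal zero_neq_one)
  then have "card (?v ` {1..N}) = N"
    by (simp add: card_image)
  moreover have "independent (?v ` {1..N})"
  proof (rule pairwise_orthogonal_independent)
    show "pairwise orthogonal (?v ` {1..N})"
      by (auto simp: pairwise_def orthogonal_def orthonormal simp del: arnoldi_vec.simps)
    show "0 \<notin> ?v ` {1..N}"
      using orthonormal by (metis imageE inner_zero_left zero_neq_one)
  qed
  ultimately show False
    using independent_bound [of "?v ` {1..N}"] by (simp add: N_def)
qed

lemma ex_rrgmres_terminates_at: "\<exists>k. rrgmres_terminates_at G c w0 k"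
proof (cases "G *v (c - G *v w0) = 0")
  case True
  then show ?thesis
    by (auto simp: rrgmres_terminates_at_def)
next
  case False
  define k where "k = (LEAST j. 1 \<le> j \<and> arnoldi_subdiag G (c - G *v w0) j = 0)"
  have "1 \<le> k \<and> arnoldi_subdiag G (c - G *v w0) k = 0"
    unfolding k_def using ex_arnoldi_subdiag_eq_0 [OF False] by (rule LeastI_ex)
  moreover have "\<forall>j. 1 \<le> j \<and> j < k \<longrightarrow> arnoldi_subdiag G (c - G *v w0) j \<noteq> 0"
    using not_less_Least by (auto simp only: k_def)
  ultimately have "rrgmres_terminates_at G c w0 k"
    using False by (simp only: rrgmres_terminates_at_def Let_def if_False simp_thms)
  then show ?thesis ..
qed

text \<open>The recurrence expresses the image of vector \<open>j\<close> by vectors up to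
  \<open>j + 1\<close>. For \<open>j < k\<close> these lie in the span; for \<open>j = k\<close> the
  coefficient of the junk vector \<open>k + 1\<close> is zero.\<close>

lemma arnoldi_span_invariant:
  assumes stop: "arnoldi_subdiag G s k = 0" and j: "j \<in> {1..k}"
  shows "G *v arnoldi_vec G s j \<in> span (arnoldi_vec G s ` {1..k})"
proof -
  let ?v = "arnoldi_vec G s"
  have "G *v ?v j = arnoldi_subdiag G s j *\<^sub>R ?v (Suc j)
      + (\<Sum>i = 1..j. (?v i \<bullet> (G *v ?v j)) *\<^sub>R ?v i)"
    using arnoldi_vec_Suc [of j G s] j by (simp del: arnoldi_vec.simps)
  also have "\<dots> \<in> span (?v ` {1..k})"
  proof (rule span_add)
    show "arnoldi_subdiag G s j *\<^sub>R ?v (Suc j) \<in> span (?v ` {1..k})"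
    proof (cases "j = k")
      case True
      then show ?thesis
        using stop by (simp add: span_zero)
    next
      case False
      then have "Suc j \<in> {1..k}"
        using j by auto
      then show ?thesis
        by (intro span_mul span_base imageI)
    qed
    show "(\<Sum>i = 1..j. (?v i \<bullet> (G *v ?v j)) *\<^sub>R ?v i) \<in> span (?v ` {1..k})"
      using j by (intro span_sum span_mul span_base imageI) auto
  qed
  finally show ?thesis .
qed

section \<open>Iterates and the final residual\<close>

text \<open>This form turns the minimization into best approximation of the initial residual by the
  vectors \<open>G *v arnoldi_vec G (c - G *v w0) i\<close>.\<close>

lemma rrgmres_residual:
  "c - G *v rrgmres_point G c w0 k y = (c - G *v w0)
     - (\<Sum>i = 1..k. y i *\<^sub>R (G *v arnoldi_vec G (c - G *v w0) i))"
  by (simp add: rrgmres_point_def matrix_vector_right_distrib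
      linear_sum [OF matrix_vector_mul_linear] matrix_vector_mult_scaleR)

lemma ex_rrgmres_iterate: "\<exists>w. rrgmres_iterate G c w0 k w"
  unfolding rrgmres_iterate_def rrgmres_residual
  using ex_best_combination [of "c - G *v w0" "\<lambda>i. G *v arnoldi_vec G (c - G *v w0) i" k] by blast

lemma rrgmres_final_residual_kernel:
  assumes sym: "transpose G = G"
    and stop: "rrgmres_terminates_at G c w0 k" and iter: "rrgmres_iterate G c w0 k w"
  shows "G *v (c - G *v w) = 0"
proof (cases "G *v (c - G *v w0) = 0")
  case True
  \<comment> \<open>Here \<open>k = 0\<close>, so the sum in \<open>rrgmres_point\<close> is
    empty.\<close>
  then have "w = w0"
    using stop iter by (auto simp: rrgmres_terminates_at_def rrgmres_iterate_def rrgmres_point_def)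
  then show ?thesis
    using True by simp
next
  case False
  define s where "s = c - G *v w0"
  let ?v = "arnoldi_vec G s"
  define V where "V = span (?v ` {1..k})"
  have k: "1 \<le> k" "arnoldi_subdiag G s k = 0"
    using stop False by (auto simp: rrgmres_terminates_at_def s_def Let_def)
  obtain y where
    min: "is_arg_min (\<lambda>y. norm (s - (\<Sum>i = 1..k. y i *\<^sub>R (G *v ?v i)))) (\<lambda>_. True) y"
    and w: "w = rrgmres_point G c w0 k y"
    using iter by (auto simp: rrgmres_iterate_def rrgmres_residual s_def)
  define r where "r = c - G *v w"
  have r: "r = s - (\<Sum>i = 1..k. y i *\<^sub>R (G *v ?v i))"
    by (simp add: r_def w rrgmres_residual s_def)
  have invariant: "G *v p \<in> V" if "p \<in> V" for p
    using that unfolding V_def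
  proof (induction rule: span_induct_alt)
    case base
    then show ?case by (simp add: span_zero)
  next
    case (step a x p)
    then show ?case
      using arnoldi_span_invariant [OF k(2)]
      by (auto simp: matrix_vector_right_distrib matrix_vector_mult_scaleR
          intro!: span_add span_mul simp del: arnoldi_vec.simps)
  qed
  have v: "?v i \<in> V" if "i \<in> {1..k}" for i
    using that by (simp add: V_def span_base del: arnoldi_vec.simps)
  \<comment> \<open>Undoing the normalization of the first vector recovers \<open>G *v s\<close>;
    the range-restricted start is what places it in \<open>V\<close>.\<close>
  have "norm (G *v s) *\<^sub>R ?v 1 \<in> V"
    unfolding V_def using k(1) by (intro span_mul span_base imageI) auto
  then have "G *v s \<in> V"
    using False by (simp add: s_def)
  moreover have "G *v (\<Sum>i = 1..k. y i *\<^sub>R (G *v ?v i)) \<in> V"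
    \<comment> \<open>Invariance is used twice: for each \<open>G *v ?v i\<close>, and for the image
      under \<open>G\<close> of their combination.\<close>
    by (intro invariant) (unfold V_def, intro span_sum span_mul, fold V_def, intro invariant v)
  ultimately have "G *v r \<in> V"
    by (simp add: r matrix_vector_mult_diff_distrib V_def span_diff)
  moreover have "orthogonal (G *v r) x" if x: "x \<in> ?v ` {1..k}" for x
  proof -
    obtain j where j: "j \<in> {1..k}" "x = ?v j"
      using x by blast
    \<comment> \<open>Symmetry enters here: it moves \<open>G\<close> from \<open>r\<close> onto the
      basis vector, where minimality applies.\<close>
    have "G *v r = r v* G"
      using transpose_matrix_vector [of G r] unfolding sym .
    then have "(G *v r) \<bullet> ?v j = r \<bullet> (G *v ?v j)"
      by (simp only: dot_lmul_matrix)
    also have "\<dots> = 0"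
      using best_combination_orthogonal [OF min j(1)] by (simp add: r)
    finally show ?thesis
      by (simp add: orthogonal_def j(2))
  qed
  \<comment> \<open>A vector of \<open>V\<close> orthogonal to the generators of \<open>V\<close> is
    orthogonal to itself.\<close>
  ultimately have "orthogonal (G *v r) (G *v r)"
    unfolding V_def by (rule orthogonal_to_span)
  then show ?thesis
    by (simp add: orthogonal_self r_def)
qed

theorem mainTheorem2:
  fixes A :: "real^'n^'m" and C :: "real^'n^'n" and B :: "real^'m^'n"
    and b :: "real^'m" and x0 :: "real^'n"
  assumes "symmetric_positive_definite C"
    and "B = C ** transpose A"
  shows "right_rrgmres_determines_ls_without_breakdown A B b x0"
proof -
  obtain k where k: "rrgmres_terminates_at (A ** B) (b - A *v x0) 0 k"
    using ex_rrgmres_terminates_at by blast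
  have sym: "transpose (A ** B) = A ** B"
    using assms by (simp add: symmetric_congruence symmetric_positive_definite_def)
  have "least_squares_solution A b x" if x: "right_rrgmres_iterate A B b x0 k x" for x
  proof -
    obtain w where w: "rrgmres_iterate (A ** B) (b - A *v x0) 0 k w" "x = x0 + B *v w"
      using x by (auto simp: right_rrgmres_iterate_def)
    \<comment> \<open>The residual of the preconditioned system at \<open>w\<close> is the residual
      of the original problem at \<open>x\<close>.\<close>
    have "b - A *v x0 - (A ** B) *v w = b - A *v x"
      by (simp add: w(2) matrix_vector_right_distrib matrix_vector_mul_assoc)
    then have "(A ** B) *v (b - A *v x) = 0"
      using rrgmres_final_residual_kernel [OF sym k w(1)] by argo
    then show ?thesis
      using kernel_congruence assms least_squares_solutionI_normal_equations by blast
  qed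
  moreover have "\<exists>x. right_rrgmres_iterate A B b x0 k x"
    using ex_rrgmres_iterate by (auto simp: right_rrgmres_iterate_def)
  ultimately show ?thesis
    using k by (auto simp: right_rrgmres_determines_ls_without_breakdown_def
        right_rrgmres_terminates_at_def)
qed

end
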